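(* Let $N,K,M\ge 1$ be integers, let $\mathbf{h}_{k,n}\in\mathbb{C}^{M\times 1}$ ($1\le k\le K$, $1\le n\le N$), and let $\sigma^2>0$, $B>0$, $\bar P_n>0$, $\bar T_n>0$ ($1\le n\le N$). Consider the iterative link-removal algorithm described in the context, with the associated quantities $\gamma^{(1,t)}$, $\gamma^{(2,t)}$ and $\gamma^{(t)}$ at iteration $t\ge1$. Then the stopping criterion $\gamma^{(1,t)}\le\gamma^{(2,t)}$ is guaranteed to be satisfied at some iteration; denote by $t^\ast$ the iteration at which it is (first) satisfied. Moreover, before the stopping criterion is satisfied, the optimal value of problem (P2,t) (defined in the context) is non-decreasing after each iteration, i.e. $\gamma^{(t)}\ge\gamma^{(t-1)}$ for all $t$ with $2\le t\le t^\ast-1$.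
   Context: There are $N$ transmitters (remote radio heads, RRHs), each with $M$ antennas, and $K$ single-antenna users. $\mathbf{h}_{k,n}\in\mathbb{C}^{M\times1}$ is the channel from RRH $n$ to user $k$, $\sigma^2$ is the noise power, $B$ the bandwidth, $\bar P_n$ the power budget and $\bar T_n$ the fronthaul capacity of RRH $n$. For beamforming vectors $\mathbf{w}_{k,n}\in\mathbb{C}^{M\times 1}$ ($1\le k\le K$, $1\le n\le N$), the signal-to-interference-plus-noise ratio (SINR) of user $k$ is $$\gamma_k=\frac{\left|\sum_{n=1}^N\mathbf{h}_{k,n}^H\mathbf{w}_{k,n}\right|^2}{\sum_{j\ne k}\left|\sum_{n=1}^N\mathbf{h}_{k,n}^H\mathbf{w}_{j,n}\right|^2+\sigma^2}.$$ Problems at iteration $t$. Given sets $\Omega_n^{(t)}\subseteq\mathcal{K}=\{1,\dots,K\}$, $1\le n\le N$ (users served by RRH $n$), problem (P2,t) is to maximize $\gamma$ over $\{\mathbf{w}_{k,n}\}$ and real $\gamma\ge0$ subject to (i) $\gamma_k\ge\gamma$ for all $k$; (ii) $\sum_{k=1}^K\|\mathbf{w}_{k,n}\|^2\le\bar P_n$ for all $n$; (iii) $B|\Omega_n^{(t)}|\log_2(1+\gamma)\le\bar T_n$ for all $n$; (iv) $\|\mathbf{w}_{k,n}\|^2=0$ for all $n$ and all $k\notin\Omega_n^{(t)}$. Let $\gamma^{(t)}$ denote the optimal value of (P2,t); let $\gamma^{(1,t)}$ denote the optimal value of the problem with constraints (i), (ii), (iv) only; and let $\gamma^{(2,t)}=\min_{1\le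 n\le N}2^{\bar T_n/(B|\Omega_n^{(t)}|)}-1$, the optimal value of the problem with constraint (iii) only (with the convention $2^{\bar T_n/(B|\Omega_n^{(t)}|)}=+\infty$ if $\Omega_n^{(t)}=\emptyset$). Algorithm. Start with $\Omega_n^{(1)}=\mathcal{K}$ for all $n$. At iteration $t=1,2,\dots$: if $\gamma^{(1,t)}\le\gamma^{(2,t)}$, terminate. Otherwise ($\gamma^{(1,t)}>\gamma^{(2,t)}$) choose an active link, i.e. a pair $(k^{(t)},n^{(t)})$ with $k^{(t)}\in\Omega_{n^{(t)}}^{(t)}$, and set $\Omega_n^{(t+1)}=\Omega_n^{(t)}\setminus\{k^{(t)}\}$ if $n=n^{(t)}$ and $\Omega_n^{(t+1)}=\Omega_n^{(t)}$ otherwise; then proceed to iteration $t+1$. The choice of the active link at each iteration may be arbitrary. *)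

theory Defs
  imports "HOL-Analysis.Analysis"
begin

text \<open>
  Users, transmitters and antennas are indexed by finite types \<open>'k\<close>, \<open>'n\<close>, \<open>'m\<close>, so that
  \<open>K = CARD('k)\<close>, \<open>N = CARD('n)\<close> and \<open>M = CARD('m)\<close> are arbitrary positive integers.
  The argument \<open>s2\<close> is the noise power (the square of the noise standard deviation).
\<close>

definition herm :: "complex ^ 'm \<Rightarrow> complex ^ 'm \<Rightarrow> complex"
  where "herm a b = (\<Sum>i\<in>UNIV. cnj (a $ i) * b $ i)"

type_synonym ('k, 'n, 'm) vecs = "'k \<Rightarrow> 'n \<Rightarrow> complex ^ 'm"

definition sinr :: "('k::finite, 'n::finite, 'm::finite) vecs \<Rightarrow> real \<Rightarrow> ('k, 'n, 'm) vecs \<Rightarrow> 'k \<Rightarrow> real"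
  where "sinr h s2 w k =
    (cmod (\<Sum>n\<in>UNIV. herm (h k n) (w k n)))\<^sup>2 /
    ((\<Sum>j\<in>UNIV - {k}. (cmod (\<Sum>n\<in>UNIV. herm (h k n) (w j n)))\<^sup>2) + s2)"

definition sinr_constraint ::
    "('k::finite, 'n::finite, 'm::finite) vecs \<Rightarrow> real \<Rightarrow> ('k, 'n, 'm) vecs \<Rightarrow> real \<Rightarrow> bool"
  where "sinr_constraint h s2 w \<gamma> \<longleftrightarrow> (\<forall>k. sinr h s2 w k \<ge> \<gamma>)"

definition power_constraint ::
    "('n \<Rightarrow> real) \<Rightarrow> ('k::finite, 'n::finite, 'm::finite) vecs \<Rightarrow> bool"
  where "power_constraint P w \<longleftrightarrow> (\<forall>n. (\<Sum>k\<in>UNIV. (norm (w k n))\<^sup>2) \<le> P n)"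

definition fronthaul_constraint ::
    "real \<Rightarrow> ('n \<Rightarrow> real) \<Rightarrow> ('n::finite \<Rightarrow> 'k::finite set) \<Rightarrow> real \<Rightarrow> bool"
  where "fronthaul_constraint B T \<Omega> \<gamma> \<longleftrightarrow> (\<forall>n. B * real (card (\<Omega> n)) * log 2 (1 + \<gamma>) \<le> T n)"

definition link_constraint ::
    "('n \<Rightarrow> 'k set) \<Rightarrow> ('k::finite, 'n::finite, 'm::finite) vecs \<Rightarrow> bool"
  where "link_constraint \<Omega> w \<longleftrightarrow> (\<forall>n. \<forall>k. k \<notin> \<Omega> n \<longrightarrow> (norm (w k n))\<^sup>2 = 0)"

definition feasible_P2 ::
    "('k::finite, 'n::finite, 'm::finite) vecs \<Rightarrow> real \<Rightarrow> real \<Rightarrow> ('n \<Rightarrow> real) \<Rightarrow> ('n \<Rightarrow> real)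
      \<Rightarrow> ('n \<Rightarrow> 'k set) \<Rightarrow> (('k, 'n, 'm) vecs \<times> real) set"
  where "feasible_P2 h s2 B P T \<Omega> =
    {(w, \<gamma>). \<gamma> \<ge> 0 \<and> sinr_constraint h s2 w \<gamma> \<and> power_constraint P w \<and>
       fronthaul_constraint B T \<Omega> \<gamma> \<and> link_constraint \<Omega> w}"

definition feasible_power ::
    "('k::finite, 'n::finite, 'm::finite) vecs \<Rightarrow> real \<Rightarrow> ('n \<Rightarrow> real)
      \<Rightarrow> ('n \<Rightarrow> 'k set) \<Rightarrow> (('k, 'n, 'm) vecs \<times> real) set"
  where "feasible_power h s2 P \<Omega> =
    {(w, \<gamma>). \<gamma> \<ge> 0 \<and> sinr_constraint h s2 w \<gamma> \<and> power_constraint P w \<and> link_constraint \<Omega> w}"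

text \<open>
  Optimal values are suprema of the objective in \<^typ>\<open>ereal\<close>, so no value is assigned by
  convention to unbounded problems and \<open>gamma2\<close> can take the value \<open>\<infinity>\<close>.
\<close>

definition gamma_opt ::
    "('k::finite, 'n::finite, 'm::finite) vecs \<Rightarrow> real \<Rightarrow> real \<Rightarrow> ('n \<Rightarrow> real) \<Rightarrow> ('n \<Rightarrow> real)
      \<Rightarrow> ('n \<Rightarrow> 'k set) \<Rightarrow> ereal"
  where "gamma_opt h s2 B P T \<Omega> = (SUP (w, \<gamma>) \<in> feasible_P2 h s2 B P T \<Omega>. ereal \<gamma>)"

definition gamma1 ::
    "('k::finite, 'n::finite, 'm::finite) vecs \<Rightarrow> real \<Rightarrow> ('n \<Rightarrow> real) \<Rightarrow> ('n \<Rightarrow> 'k set) \<Rightarrow> ereal"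
  where "gamma1 h s2 P \<Omega> = (SUP (w, \<gamma>) \<in> feasible_power h s2 P \<Omega>. ereal \<gamma>)"

definition gamma2 :: "real \<Rightarrow> ('n \<Rightarrow> real) \<Rightarrow> ('n::finite \<Rightarrow> 'k::finite set) \<Rightarrow> ereal"
  where "gamma2 B T \<Omega> =
    (MIN n. if \<Omega> n = {} then \<infinity> else ereal (2 powr (T n / (B * real (card (\<Omega> n)))) - 1))"

definition stops ::
    "('k::finite, 'n::finite, 'm::finite) vecs \<Rightarrow> real \<Rightarrow> real \<Rightarrow> ('n \<Rightarrow> real) \<Rightarrow> ('n \<Rightarrow> real)
      \<Rightarrow> ('n \<Rightarrow> 'k set) \<Rightarrow> bool"
  where "stops h s2 B P T \<Omega> \<longleftrightarrow> gamma1 h s2 P \<Omega> \<le> gamma2 B T \<Omega>"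

text \<open>
  \<open>\<Omega> t\<close> are the served sets and \<open>(kk t, nn t)\<close> the link chosen at iteration \<open>t \<ge> 1\<close>. Nothing is
  assumed about iterations after the first at which the stopping criterion holds. The choice is
  required to be active only when some active link exists: if the algorithm could get stuck
  with no active link while the criterion fails, \<open>\<Omega>\<close> would simply stay constant. Such a
  deadlock is therefore not excluded by hypothesis.
\<close>

definition algorithm_run ::
    "('k::finite, 'n::finite, 'm::finite) vecs \<Rightarrow> real \<Rightarrow> real \<Rightarrow> ('n \<Rightarrow> real) \<Rightarrow> ('n \<Rightarrow> real)
      \<Rightarrow> (nat \<Rightarrow> 'n \<Rightarrow> 'k set) \<Rightarrow> (nat \<Rightarrow> 'k) \<Rightarrow> (nat \<Rightarrow> 'n) \<Rightarrow> bool"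
  where "algorithm_run h s2 B P T \<Omega> kk nn \<longleftrightarrow>
    (\<forall>n. \<Omega> 1 n = UNIV) \<and>
    (\<forall>t\<ge>1. (\<forall>s\<in>{1..t}. \<not> stops h s2 B P T (\<Omega> s)) \<longrightarrow>
       ((\<exists>n k. k \<in> \<Omega> t n) \<longrightarrow> kk t \<in> \<Omega> t (nn t)) \<and>
       (\<forall>n. \<Omega> (t + 1) n = (if n = nn t then \<Omega> t n - {kk t} else \<Omega> t n)))"

end

theory Submission
  imports Defs
begin

text \<open>
  A removal step shrinks the total number of active links, and without active links
  \<open>gamma2 = \<infinity>\<close>, so the algorithm stops. The fronthaul constraint is equivalent to
  \<open>\<gamma> \<le> gamma2\<close>; as long as \<open>gamma1 > gamma2\<close>, lowering the SINR target of a power-feasible point to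
  \<open>gamma2\<close> shows that the optimal value is \<open>gamma2\<close>, which can only grow when links are removed.
\<close>

text \<open>A bound on a minimum over a finite nonempty index type splits into one bound per
  transmitter; a transmitter without users contributes \<open>\<infinity>\<close> and drops
  out.\<close>

lemma le_gamma2_iff:
  fixes \<Omega> :: "'n::finite \<Rightarrow> 'k::finite set"
  shows "x \<le> gamma2 B T \<Omega> \<longleftrightarrow>
    (\<forall>n. \<Omega> n \<noteq> {} \<longrightarrow> x \<le> ereal (2 powr (T n / (B * real (card (\<Omega> n)))) - 1))"
  unfolding gamma2_def by (subst Min_ge_iff) auto

text \<open>Divide by \<open>B * card (\<Omega> n)\<close> and exponentiate;
  \<open>\<gamma> > -1\<close> keeps the argument of the logarithm positive. For an empty
  \<open>\<Omega> n\<close> the constraint reads \<open>0 \<le> T n\<close>, which matches the entry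
  \<open>\<infinity>\<close>.\<close>

lemma fronthaul_constraint_iff:
  fixes \<Omega> :: "'n::finite \<Rightarrow> 'k::finite set"
  assumes B: "B > 0" and T: "\<And>n. T n \<ge> 0" and \<gamma>: "\<gamma> > -1"
  shows "fronthaul_constraint B T \<Omega> \<gamma> \<longleftrightarrow> ereal \<gamma> \<le> gamma2 B T \<Omega>"
proof -
  have "B * real (card (\<Omega> n)) * log 2 (1 + \<gamma>) \<le> T n \<longleftrightarrow>
      (\<Omega> n \<noteq> {} \<longrightarrow> ereal \<gamma> \<le> ereal (2 powr (T n / (B * real (card (\<Omega> n)))) - 1))" for n
  proof (cases "\<Omega> n = {}")
    case True
    then show ?thesis using T by simp
  next
    case False
    then have c: "B * real (card (\<Omega> n)) > 0"
      using B by (simp add: card_gt_0_iff)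
    have "B * real (card (\<Omega> n)) * log 2 (1 + \<gamma>) \<le> T n \<longleftrightarrow>
        log 2 (1 + \<gamma>) \<le> T n / (B * real (card (\<Omega> n)))"
      using c by (simp add: pos_le_divide_eq mult.commute)
    also have "\<dots> \<longleftrightarrow> 1 + \<gamma> \<le> 2 powr (T n / (B * real (card (\<Omega> n))))"
      using \<gamma> by (intro log_le_iff) auto
    finally show ?thesis using False by auto
  qed
  then show ?thesis
    unfolding fronthaul_constraint_def le_gamma2_iff by simp
qed

lemma gamma2_empty: "(\<And>n. \<Omega> n = {}) \<Longrightarrow> gamma2 B T \<Omega> = \<infinity>"
  unfolding gamma2_def by simp

text \<open>The target 0 meets every fronthaul constraint because
  \<open>log 2 1 = 0\<close>.\<close>

lemma gamma2_nonneg: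
  fixes \<Omega> :: "'n::finite \<Rightarrow> 'k::finite set"
  assumes "B > 0" "\<And>n. T n \<ge> 0"
  shows "gamma2 B T \<Omega> \<ge> 0"
  using assms fronthaul_constraint_iff[of B T 0 \<Omega>]
  by (simp add: fronthaul_constraint_def zero_ereal_def)

text \<open>Fewer users share the same fronthaul capacity, so each exponent grows; a set that
  becomes empty only removes a term from the minimum.\<close>

lemma gamma2_antimono:
  fixes \<Omega> \<Omega>' :: "'n::finite \<Rightarrow> 'k::finite set"
  assumes B: "B > 0" and T: "\<And>n. T n \<ge> 0" and sub: "\<And>n. \<Omega>' n \<subseteq> \<Omega> n"
  shows "gamma2 B T \<Omega> \<le> gamma2 B T \<Omega>'"
  unfolding le_gamma2_iff[of _ B T \<Omega>']
proof (intro allI impI)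
  fix n assume ne: "\<Omega>' n \<noteq> {}"
  have "card (\<Omega>' n) > 0" "card (\<Omega>' n) \<le> card (\<Omega> n)"
    using ne sub by (simp_all add: card_gt_0_iff card_mono)
  then have le: "T n / (B * real (card (\<Omega> n))) \<le> T n / (B * real (card (\<Omega>' n)))"
    using B T by (intro divide_left_mono mult_left_mono mult_pos_pos) auto
  have "\<Omega> n \<noteq> {}" using ne sub by blast
  then have "gamma2 B T \<Omega> \<le> ereal (2 powr (T n / (B * real (card (\<Omega> n)))) - 1)"
    using le_gamma2_iff[of "gamma2 B T \<Omega>" B T \<Omega>] by blast
  also have "ereal (2 powr (T n / (B * real (card (\<Omega> n)))) - 1)
      \<le> ereal (2 powr (T n / (B * real (card (\<Omega>' n)))) - 1)"
    using le by simp
  finally show "gamma2 B T \<Omega> \<le> ereal (2 powr (T n / (B * real (card (\<Omega>' n)))) - 1)" .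
qed

lemma gamma_opt_le_gamma2:
  fixes \<Omega> :: "'n::finite \<Rightarrow> 'k::finite set"
  assumes "B > 0" "\<And>n. T n \<ge> 0"
  shows "gamma_opt h s2 B P T \<Omega> \<le> gamma2 B T \<Omega>"
  unfolding gamma_opt_def
proof (rule SUP_least, clarify)
  fix w \<gamma> assume "(w, \<gamma>) \<in> feasible_P2 h s2 B P T \<Omega>"
  then have "\<gamma> \<ge> 0" "fronthaul_constraint B T \<Omega> \<gamma>"
    by (auto simp: feasible_P2_def)
  then show "ereal \<gamma> \<le> gamma2 B T \<Omega>"
    using fronthaul_constraint_iff[of B T \<gamma> \<Omega>] assms by simp
qed

lemma gamma2_le_gamma_opt:
  fixes \<Omega> :: "'n::finite \<Rightarrow> 'k::finite set"
  assumes B: "B > 0" and T: "\<And>n. T n \<ge> 0" and "\<not> stops h s2 B P T \<Omega>"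
  shows "gamma2 B T \<Omega> \<le> gamma_opt h s2 B P T \<Omega>"
proof -
  from assms(3) have "gamma2 B T \<Omega> < gamma1 h s2 P \<Omega>"
    by (simp add: stops_def)
  \<comment> \<open>Being strictly below the supremum yields an actual feasible point, so attainment
    of the optimum plays no part.\<close>
  then obtain w \<gamma> where w: "(w, \<gamma>) \<in> feasible_power h s2 P \<Omega>"
    and \<gamma>: "gamma2 B T \<Omega> < ereal \<gamma>"
    unfolding gamma1_def less_SUP_iff by auto
  \<comment> \<open>The real upper bound \<open>\<gamma>\<close> excludes the value
    \<open>\<infinity>\<close> and nonnegativity excludes \<open>-\<infinity>\<close>, so
    \<open>gamma2\<close> is itself a real SINR target.\<close>
  obtain g where g: "gamma2 B T \<Omega> = ereal g" and g0: "g \<ge> 0"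
    using gamma2_nonneg[of B T \<Omega>] B T \<gamma> by (cases "gamma2 B T \<Omega>") auto
  have "fronthaul_constraint B T \<Omega> g"
    using fronthaul_constraint_iff[of B T g \<Omega>] B T g g0 by simp
  moreover have "g < \<gamma>" using g \<gamma> by simp
  \<comment> \<open>The beamformers stay the same: power and link constraints do not involve the
    target, and the SINR constraint only relaxes.\<close>
  ultimately have "(w, g) \<in> feasible_P2 h s2 B P T \<Omega>"
    using w g0 by (auto simp: feasible_P2_def feasible_power_def sinr_constraint_def
        intro: order_trans less_imp_le)
  then show ?thesis
    unfolding g gamma_opt_def by (rule SUP_upper2) simp
qed

theorem proposition4p3:
  fixes h :: "'k::finite \<Rightarrow> 'n::finite \<Rightarrow> complex ^ 'm::finite"
    and s2 B :: real and P T :: "'n \<Rightarrow> real"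
    and \<Omega> :: "nat \<Rightarrow> 'n \<Rightarrow> 'k set" and kk :: "nat \<Rightarrow> 'k" and nn :: "nat \<Rightarrow> 'n"
  assumes "s2 > 0" and "B > 0" and "\<And>n. P n > 0" and "\<And>n. T n > 0"
    and "algorithm_run h s2 B P T \<Omega> kk nn"
  shows "\<exists>tstar\<ge>1. stops h s2 B P T (\<Omega> tstar) \<and>
           (\<forall>s\<in>{1..<tstar}. \<not> stops h s2 B P T (\<Omega> s)) \<and>
           (\<forall>t. 2 \<le> t \<and> t \<le> tstar - 1 \<longrightarrow>
              gamma_opt h s2 B P T (\<Omega> t) \<ge> gamma_opt h s2 B P T (\<Omega> (t - 1)))"
proof -
  let ?stop = "\<lambda>t. stops h s2 B P T (\<Omega> t)"
  let ?active = "\<lambda>t. \<Sum>n\<in>UNIV. card (\<Omega> t n)"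
  have T: "T n \<ge> 0" for n using assms(4)[of n] by simp
  have step: "(\<exists>n k. k \<in> \<Omega> t n) \<longrightarrow> kk t \<in> \<Omega> t (nn t)"
    "\<Omega> (Suc t) n = (if n = nn t then \<Omega> t n - {kk t} else \<Omega> t n)"
    if "t \<ge> 1" "\<forall>s\<in>{1..t}. \<not> ?stop s" for t n
    using assms(5) that unfolding algorithm_run_def Suc_eq_plus1 by blast+
  have decrease: "?active (Suc t) < ?active t" if t: "t \<ge> 1" "\<forall>s\<in>{1..t}. \<not> ?stop s" for t
  proof -
    \<comment> \<open>No deadlock: without active links \<open>gamma2\<close> would be
      \<open>\<infinity>\<close> and the criterion would hold. Only now does
      \<open>algorithm_run\<close> guarantee that the chosen link is active.\<close>
    have "\<exists>n. \<Omega> t n \<noteq> {}"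
      using t gamma2_empty[of "\<Omega> t" B T] by (force simp: stops_def)
    then have active: "kk t \<in> \<Omega> t (nn t)" using step(1)[OF t] by blast
    show ?thesis
    proof (rule sum_strict_mono_ex1)
      show "\<forall>n\<in>UNIV. card (\<Omega> (Suc t) n) \<le> card (\<Omega> t n)"
        by (auto simp: step(2)[OF t] intro!: card_mono)
      show "\<exists>n\<in>UNIV. card (\<Omega> (Suc t) n) < card (\<Omega> t n)"
        using active step(2)[OF t, of "nn t"] by (metis UNIV_I card_Diff1_less finite)
    qed simp
  qed
  have ex: "\<exists>t\<ge>1. ?stop t"
  proof (rule ccontr)
    assume "\<not> ?thesis"
    \<comment> \<open>The shift by one makes the descending chain start at iteration 1, the first
      one governed by \<open>decrease\<close>.\<close>
    then have "?active (Suc (Suc i)) < ?active (Suc i)" for i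
      using decrease[of "Suc i"] by simp
    then show False
      using wf_no_infinite_down_chainE[OF wf_less, of "\<lambda>i. ?active (Suc i)"] by blast
  qed
  define tstar where "tstar = (LEAST t. t \<ge> 1 \<and> ?stop t)"
  have tstar: "tstar \<ge> 1" "?stop tstar"
    using LeastI_ex[OF ex] by (auto simp: tstar_def)
  have before: "\<not> ?stop s" if "s \<in> {1..<tstar}" for s
    using not_less_Least[of s "\<lambda>t. t \<ge> 1 \<and> ?stop t"] that by (auto simp: tstar_def)
  have "gamma_opt h s2 B P T (\<Omega> (t - 1)) \<le> gamma_opt h s2 B P T (\<Omega> t)"
    if t: "2 \<le> t" "t \<le> tstar - 1" for t
  proof -
    have "t - 1 \<ge> 1" "\<forall>s\<in>{1..t - 1}. \<not> ?stop s" "Suc (t - 1) = t"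
      using t before by auto
    then have "\<Omega> t n \<subseteq> \<Omega> (t - 1) n" for n
      using step(2)[of "t - 1" n] by (metis Diff_subset order_refl)
    then have "gamma2 B T (\<Omega> (t - 1)) \<le> gamma2 B T (\<Omega> t)"
      by (intro gamma2_antimono assms(2) T)
    \<comment> \<open>Failure of the criterion at \<open>t\<close> itself, hence the range up to
      \<open>tstar - 1\<close>, gives \<open>gamma2 \<le> gamma_opt\<close> at \<open>t\<close>. At
      \<open>t - 1\<close> the general bound \<open>gamma_opt \<le> gamma2\<close> suffices, and
      monotonicity of \<open>gamma2\<close> joins the two.\<close>
    moreover have "\<not> ?stop t" using before t by auto
    ultimately show ?thesis
      using gamma_opt_le_gamma2 gamma2_le_gamma_opt assms(2) T by (meson order_trans)
  qed
  with tstar before show ?thesis by blast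
qed

end
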